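(* Let $G$ be a connected compact Hausdorff abelian group with Haar probability measure $\mu$, let $\alpha$ be a real number, and let $A,B$ be $K$-analytic subsets of $G$ satisfying $0<\mu(A+B)\leq \alpha\,\mu(A)$. Then for every positive integer $n$ such that $\alpha^n<1/\mu(A)$, we have $\mu(nB)\leq (\alpha^n-1)\,\mu(A)$.
   Context: A subset $S$ of a topological space $Y$ is a $K_{\sigma\delta}$ set if $S=\bigcap_{i\in\mathbb{N}}\bigcup_{j\in\mathbb{N}}K_{i,j}$ for compact sets $K_{i,j}\subset Y$. A subset $A$ of a Hausdorff space $X$ is $K$-analytic if there is a $K_{\sigma\delta}$ set $S$ in some compact Hausdorff space and a continuous map $f:S\to X$ with $A=f(S)$. $nB=\{b_1+\dots+b_n:b_i\in B\}$. *)

theory Defs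
  imports "HOL-Probability.Probability"
begin

definition sumset :: "'a::plus set \<Rightarrow> 'a set \<Rightarrow> 'a set" where
  "sumset A B = {a + b | a b. a \<in> A \<and> b \<in> B}"

definition nfold_sumset :: "nat \<Rightarrow> 'a::comm_monoid_add set \<Rightarrow> 'a set" where
  "nfold_sumset n B = {(\<Sum>i<n. b i) | b. \<forall>i<n. b i \<in> B}"

definition K_sigma_delta :: "'y topology \<Rightarrow> 'y set \<Rightarrow> bool" where
  "K_sigma_delta Y S \<longleftrightarrow>
     (\<exists>K :: nat \<Rightarrow> nat \<Rightarrow> 'y set. (\<forall>i j. compactin Y (K i j)) \<and> S = (\<Inter>i. \<Union>j. K i j))"

text \<open>K-analytic subsets of a Hausdorff space X (the type topology of 'a), witnessed by a
  compact Hausdorff space whose carrier lives in the type 'y.  Used as a hypothesis with a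
  free type variable 'y, this expresses "for some compact Hausdorff space Y".\<close>
definition K_analytic :: "'y itself \<Rightarrow> 'a::topological_space set \<Rightarrow> bool" where
  "K_analytic (_::'y itself) A \<longleftrightarrow>
     (\<exists>(Y::'y topology) S (f::'y \<Rightarrow> 'a).
        compact_space Y \<and> Hausdorff_space Y \<and> K_sigma_delta Y S \<and>
        continuous_map (subtopology Y S) euclidean f \<and> f ` S = A)"

definition haar_probability :: "'a::{topological_ab_group_add, t2_space} measure \<Rightarrow> bool" where
  "haar_probability M \<longleftrightarrow>
     sets M = sets borel \<and> prob_space M \<and>
     (\<forall>x. \<forall>S\<in>sets M. emeasure M ((\<lambda>y. x + y) ` S) = emeasure M S) \<and>
     (\<forall>S\<in>sets M. emeasure M S = (INF U\<in>{U. open U \<and> S \<subseteq> U}. emeasure M U)) \<and>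
     (\<forall>U. open U \<longrightarrow> emeasure M U = (SUP K\<in>{K. compact K \<and> K \<subseteq> U}. emeasure M K))"

end

theory Submission
  imports Defs
begin

text \<open>
  Approximating \<open>A\<close> from inside by a compact \<open>A'\<close> and \<open>A + B\<close> from outside by an open \<open>U\<close>,
  one may replace \<open>B\<close> by the open set of all \<open>b\<close> with \<open>A' + b \<subseteq> U\<close>.
  For open \<open>B\<close>, a compact subset of \<open>nB\<close> lies in
  \<open>B + (n-1)F\<close> for some finite \<open>F \<subseteq> B\<close>, and Petridis' proof of Pluennecke's inequality gives
  a compact \<open>X \<subseteq> A\<close> with \<open>\<mu>(X + B + (n-1)F) \<le> \<alpha>'^n \<mu>(X)\<close> for any \<open>\<alpha>' > \<alpha>\<close>. Kneser's inequality
  \<open>\<mu>(X + D) \<ge> min 1 (\<mu>(X) + \<mu>(D))\<close> in connected groups then bounds \<open>\<mu>(nB)\<close>. It is proved by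
  submodularity of \<open>X \<mapsto> \<mu>(X + D)\<close> applied to \<open>X\<close> and \<open>g + X\<close>, where connectedness lets
  \<open>\<mu>(X \<inter> (g + X))\<close> take every value between \<open>\<mu>(X)\<^sup>2\<close> and \<open>\<mu>(X)\<close>.
\<close>

section \<open>Algebra and topology of sumsets\<close>

lemma mem_sumset: "x \<in> sumset A B \<longleftrightarrow> (\<exists>a\<in>A. \<exists>b\<in>B. x = a + b)"
  by (auto simp: sumset_def)

lemma sumset_conv_image: "sumset A B = (\<lambda>(a, b). a + b) ` (A \<times> B)"
  by (auto simp: sumset_def)

lemma sumset_mono: "A \<subseteq> A' \<Longrightarrow> B \<subseteq> B' \<Longrightarrow> sumset A B \<subseteq> sumset A' B'"
  by (auto simp: sumset_def)

lemma sumset_assoc: "sumset (sumset A B) C = sumset A (sumset B (C :: 'a::semigroup_add set))"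
proof (intro set_eqI iffI)
  fix x assume "x \<in> sumset (sumset A B) C"
  then obtain a b c where "a \<in> A" "b \<in> B" "c \<in> C" "x = a + (b + c)"
    by (auto simp: mem_sumset add.assoc)
  then show "x \<in> sumset A (sumset B C)" unfolding sumset_def by blast
next
  fix x assume "x \<in> sumset A (sumset B C)"
  then obtain a b c where "a \<in> A" "b \<in> B" "c \<in> C" "x = (a + b) + c"
    by (auto simp: mem_sumset add.assoc)
  then show "x \<in> sumset (sumset A B) C" unfolding sumset_def by blast
qed

lemma sumset_commute: "sumset A B = sumset B (A :: 'a::ab_semigroup_add set)"
  by (auto simp: mem_sumset set_eq_iff) (metis add.commute)+

lemma sumset_insert_right: "sumset A (insert b B) = sumset A B \<union> (\<lambda>x. x + b) ` A"
  unfolding sumset_conv_image by force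

lemma sumset_Un_left: "sumset (A \<union> B) C = sumset A C \<union> sumset B C"
  unfolding sumset_conv_image by force

lemma sumset_translate_left:
  "sumset ((\<lambda>x. g + x) ` A) B = (\<lambda>x. g + x) ` sumset A (B :: 'a::semigroup_add set)"
proof -
  have "(\<lambda>x. g + x) ` S = sumset {g} S" for S :: "'a set"
    by (auto simp: sumset_def)
  then show ?thesis by (simp add: sumset_assoc)
qed

lemma compact_sumset:
  fixes A B :: "'a::topological_monoid_add set"
  assumes "compact A" "compact B"
  shows "compact (sumset A B)"
  unfolding sumset_conv_image
  by (intro compact_continuous_image compact_Times assms)
     (auto simp: case_prod_beta intro!: continuous_intros)

lemma open_translate:
  fixes S :: "'a::topological_ab_group_add set"
  assumes "open S"
  shows "open ((\<lambda>x. g + x) ` S)"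
proof -
  have "(\<lambda>x. g + x) ` S = (\<lambda>x. x - g) -` S"
    by (auto simp: image_iff) (metis add.commute diff_add_cancel)
  also have "open \<dots>"
    by (intro open_vimage assms continuous_intros)
  finally show ?thesis .
qed

lemma open_sumset:
  fixes A B :: "'a::topological_ab_group_add set"
  assumes "open B"
  shows "open (sumset A B)"
proof -
  have "sumset A B = (\<Union>a\<in>A. (\<lambda>x. a + x) ` B)"
    by (auto simp: sumset_def)
  then show ?thesis using assms by (auto intro: open_translate)
qed

lemma nfold_sumset_0: "nfold_sumset 0 B = {0}"
  by (auto simp: nfold_sumset_def)

lemma nfold_sumset_Suc:
  "nfold_sumset (Suc n) B = sumset (nfold_sumset n B) (B :: 'a::comm_monoid_add set)"
proof (intro set_eqI iffI)
  fix x assume "x \<in> nfold_sumset (Suc n) B"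
  then obtain b where "x = (\<Sum>i<Suc n. b i)" "\<forall>i<Suc n. b i \<in> B"
    by (auto simp: nfold_sumset_def)
  then have "x = (\<Sum>i<n. b i) + b n" "(\<Sum>i<n. b i) \<in> nfold_sumset n B" "b n \<in> B"
    by (auto simp: nfold_sumset_def)
  then show "x \<in> sumset (nfold_sumset n B) B" by (auto simp: sumset_def)
next
  fix x assume "x \<in> sumset (nfold_sumset n B) B"
  then obtain b c where b: "x = (\<Sum>i<n. b i) + c" "\<forall>i<n. b i \<in> B" "c \<in> B"
    by (auto simp: nfold_sumset_def sumset_def)
  then have "x = (\<Sum>i<Suc n. (b(n := c)) i)" by simp
  moreover have "\<forall>i<Suc n. (b(n := c)) i \<in> B" using b by auto
  ultimately show "x \<in> nfold_sumset (Suc n) B" unfolding nfold_sumset_def by blast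
qed

lemma nfold_sumset_mono: "B \<subseteq> C \<Longrightarrow> nfold_sumset n B \<subseteq> nfold_sumset n C"
  by (auto simp: nfold_sumset_def)

lemma finite_nfold_sumset: "finite F \<Longrightarrow> finite (nfold_sumset n F)"
  by (induction n) (auto simp: nfold_sumset_0 nfold_sumset_Suc sumset_conv_image)

lemma nfold_sumset_nonempty: "F \<noteq> {} \<Longrightarrow> nfold_sumset n F \<noteq> {}"
  by (induction n) (auto simp: nfold_sumset_0 nfold_sumset_Suc sumset_conv_image)

lemma compact_translate:
  fixes S :: "'a::topological_ab_group_add set"
  shows "compact S \<Longrightarrow> compact ((\<lambda>x. g + x) ` S)"
  by (intro compact_continuous_image continuous_intros)

lemma compact_uminus_image:
  fixes S :: "'a::topological_ab_group_add set"
  shows "compact S \<Longrightarrow> compact (uminus ` S)"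
  by (intro compact_continuous_image continuous_intros)

text \<open>By the tube lemma. It serves twice: with \<open>X \<subseteq> U\<close> it gives a
  neighbourhood \<open>V\<close> of 0 with \<open>X + V \<subseteq> U\<close>, and in the main
  theorem it makes the enlargement of \<open>B\<close> open.\<close>

lemma open_translates_into:
  fixes X U :: "'a::topological_ab_group_add set"
  assumes "compact X" "open U"
  shows "open {g. \<forall>x\<in>X. x + g \<in> U}"
  unfolding open_subopen[of "{g. \<forall>x\<in>X. x + g \<in> U}"]
proof
  fix g assume "g \<in> {g. \<forall>x\<in>X. x + g \<in> U}"
  then have sub: "{g} \<times> X \<subseteq> (\<lambda>(g, x). x + g) -` U" by auto
  have "open ((\<lambda>(g, x :: 'a). x + g) -` U)"
    by (rule open_vimage[OF assms(2)])
       (auto simp: case_prod_beta intro!: continuous_on_add continuous_on_fst continuous_on_snd)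
  from Elementary_Topology.tube_lemma[OF assms(1) this sub]
  show "\<exists>T. open T \<and> g \<in> T \<and> T \<subseteq> {g. \<forall>x\<in>X. x + g \<in> U}"
    by fastforce
qed

text \<open>Both sides are continuous in the base of the power, so an estimate may be proved with an
  arbitrarily small loss \<open>\<alpha> < \<beta>\<close> and the loss removed in the limit from
  the right.\<close>

lemma le_if_le_perturbed_power:
  fixes v m \<alpha> :: real
  assumes "\<alpha> ^ n * m < 1"
    and "\<And>\<beta>. \<alpha> < \<beta> \<Longrightarrow> \<beta> ^ n * m < 1 \<Longrightarrow> v \<le> (\<beta> ^ n - 1) * m"
  shows "v \<le> (\<alpha> ^ n - 1) * m"
proof (rule tendsto_lowerbound)
  show "((\<lambda>\<beta>. (\<beta> ^ n - 1) * m) \<longlongrightarrow> (\<alpha> ^ n - 1) * m) (at_right \<alpha>)"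
    by (intro tendsto_intros)
  have "((\<lambda>\<beta>. \<beta> ^ n * m) \<longlongrightarrow> \<alpha> ^ n * m) (at_right \<alpha>)"
    by (intro tendsto_intros)
  then have "eventually (\<lambda>\<beta>. \<beta> ^ n * m < 1) (at_right \<alpha>)"
    using assms(1) by (rule order_tendstoD(2))
  moreover have "eventually (\<lambda>\<beta>. \<alpha> < \<beta>) (at_right \<alpha>)"
    by (simp add: eventually_at_right_less)
  ultimately show "eventually (\<lambda>\<beta>. v \<le> (\<beta> ^ n - 1) * m) (at_right \<alpha>)"
    by eventually_elim (rule assms(2))
qed simp

section \<open>Regularity and invariance of Haar measure\<close>

locale compact_haar =
  fixes M :: "'a::{topological_ab_group_add, t2_space} measure"
  assumes compact_UNIV: "compact (UNIV :: 'a set)"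
    and haar: "haar_probability M"
begin

sublocale prob_space M
  using haar by (simp add: haar_probability_def)

lemma sets_eq [simp]: "sets M = sets borel"
  using haar by (simp add: haar_probability_def)

lemma space_eq [simp]: "space M = UNIV"
  using sets_eq_imp_space_eq[OF sets_eq] by simp

lemma compact_iff_closed: "compact S \<longleftrightarrow> closed (S :: 'a set)"
  using compact_Int_closed[OF compact_UNIV, of S] compact_imp_closed by auto

lemma compact_borel: "compact (S :: 'a set) \<Longrightarrow> S \<in> sets borel"
  by (simp add: borel_closed compact_iff_closed)

lemma measure_translate: "S \<in> sets borel \<Longrightarrow> measure M ((\<lambda>y. x + y) ` S) = measure M S"
  using haar by (simp add: haar_probability_def measure_def)

lemma measure_mono: "S \<subseteq> T \<Longrightarrow> T \<in> sets borel \<Longrightarrow> measure M S \<le> measure M T"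
  by (rule finite_measure_mono) simp_all

lemma outer_regular:
  assumes "S \<in> sets borel" "0 < e"
  shows "\<exists>U. open U \<and> S \<subseteq> U \<and> measure M U < measure M S + e"
proof -
  have "(INF U\<in>{U. open U \<and> S \<subseteq> U}. emeasure M U) = emeasure M S"
    using haar assms(1) by (auto simp: haar_probability_def)
  also have "\<dots> < ennreal (measure M S + e)"
    using assms(2) by (simp add: emeasure_eq_measure ennreal_less_iff)
  finally obtain U where "open U" "S \<subseteq> U" "emeasure M U < ennreal (measure M S + e)"
    by (auto simp: INF_less_iff)
  then show ?thesis
    by (auto simp: emeasure_eq_measure ennreal_less_iff)
qed

text \<open>Outer regularity of the complement: the complement of an open set is closed, hence
  compact here. The definition of \<open>haar_probability\<close> gives inner regularity for open
  sets only.\<close>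

lemma inner_regular:
  assumes "S \<in> sets borel" "0 < e"
  shows "\<exists>K. compact K \<and> K \<subseteq> S \<and> measure M S - e < measure M K"
proof -
  obtain U where U: "open U" "- S \<subseteq> U" "measure M U < measure M (- S) + e"
    using outer_regular[of "- S" e] assms by auto
  have "measure M (- S) = 1 - measure M S" "measure M (- U) = 1 - measure M U"
    using prob_compl[of S] prob_compl[of U] assms U by (simp_all add: Compl_eq_Diff_UNIV)
  with U show ?thesis
    by (intro exI[of _ "- U"]) (auto simp: compact_iff_closed)
qed

section \<open>Intersections of a set with its translates\<close>

text \<open>Replaces Fubini, which is unavailable because the product of two Borel algebras need not
  contain the open subsets of the product space: the average over all \<open>g\<close> of the measure of
  \<open>Y \<inter> (g + X)\<close> is taken over representatives of a finite partition into small sets.\<close>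

lemma exists_small_intersection:
  fixes X Y :: "'a set"
  assumes X: "compact X" and Y: "compact Y" and e: "0 < e"
  shows "\<exists>g. measure M (Y \<inter> (\<lambda>x. g + x) ` X) \<le> measure M Y * (measure M (uminus ` X) + e)"
proof (cases "measure M Y = 0")
  case True
  have "measure M (Y \<inter> (\<lambda>x. 0 + x) ` X) \<le> measure M Y"
    by (rule measure_mono) (auto intro: compact_borel Y)
  with True show ?thesis by (intro exI[of _ 0]) simp
next
  case False
  then have Ypos: "0 < measure M Y" by (simp add: zero_less_measure_iff)
  obtain U where U: "open U" "uminus ` X \<subseteq> U" "measure M U < measure M (uminus ` X) + e"
    using outer_regular[OF compact_borel[OF compact_uminus_image[OF X]] e] by blast
  \<comment> \<open>\<open>V\<close> is a neighbourhood of 0 with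
    \<open>- X + V \<subseteq> U\<close>; the small sets of the partition lie in translates of
    it.\<close>
  define V where "V = {v. \<forall>x\<in>uminus ` X. x + v \<in> U}"
  have V: "open V" "0 \<in> V"
    unfolding V_def using U open_translates_into[OF compact_uminus_image[OF X]] by auto
  have cov: "UNIV \<subseteq> (\<Union>p\<in>UNIV. (\<lambda>x. p + x) ` V)"
    using V(2) by (force simp: image_iff)
  obtain P where P: "finite P" "UNIV \<subseteq> (\<Union>p\<in>P. (\<lambda>x. p + x) ` V)"
    using compactE_image[OF compact_UNIV, of UNIV "\<lambda>p. (\<lambda>x. p + x) ` V"] cov V(1)
    by (auto intro: open_translate)
  obtain N and h :: "nat \<Rightarrow> 'a" where h: "P = h ` {i. i < N}"
    using P(1) finite_imp_nat_seg_image_inj_on by blast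
  \<comment> \<open>The finite cover is padded with empty sets to a sequence, so that
    \<open>disjointed\<close> turns it into a partition.\<close>
  define W where "W i = (if i < N then (\<lambda>x. h i + x) ` V else {})" for i
  define Q where "Q = disjointed W"
  have Q_sub: "Q i \<subseteq> W i" for i
    unfolding Q_def by (rule disjointed_subset)
  have Q_sets: "Q i \<in> sets borel" for i
  proof -
    have "range W \<subseteq> sets borel" by (auto simp: W_def open_translate V)
    from sets.range_disjointed_sets[OF this] show ?thesis by (auto simp: Q_def)
  qed
  have disj: "disjoint_family_on Q I" for I
    using disjoint_family_disjointed[of W] by (auto simp: Q_def disjoint_family_on_def)
  have Un: "(\<Union>i<N. Q i) = UNIV"
  proof -
    have "UNIV = (\<Union>i. W i)" using P(2) by (fastforce simp: h W_def)
    also have "\<dots> = (\<Union>i. Q i)" by (simp add: Q_def UN_disjointed_eq)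
    also have "\<dots> = (\<Union>i<N. Q i)"
    proof -
      have "Q i = {}" if "\<not> i < N" for i
        using Q_sub[of i] that by (auto simp: W_def)
      then show ?thesis by fastforce
    qed
    finally show ?thesis ..
  qed
  have sum_Q: "(\<Sum>i\<in>I. measure M (Q i)) = measure M (\<Union>i\<in>I. Q i)" if "finite I" for I
    using that disj Q_sets by (intro finite_measure_finite_Union[symmetric]) auto
  have sum1: "(\<Sum>i<N. measure M (Q i)) = 1"
    using sum_Q[of "{..<N}"] Un prob_space by simp
  define T where "T i = Y \<inter> (\<lambda>x. h i + x) ` X" for i
  have T_sets: "T i \<in> sets borel" for i
    unfolding T_def using X Y by (intro sets.Int compact_borel compact_translate)
  \<comment> \<open>If \<open>x \<in> h i + X\<close>, then \<open>Q i \<subseteq> h i + V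
    \<subseteq> x - X + V \<subseteq> x + U\<close>. The cells that count at \<open>x\<close> are
    disjoint, so their total weight is at most the measure of \<open>U\<close>.\<close>
  have pointwise: "(\<Sum>i<N. measure M (Q i) * indicator (T i) x) \<le> measure M U * indicator Y x" for x
  proof (cases "x \<in> Y")
    case True
    define I where "I = {i. i < N \<and> x \<in> T i}"
    have "(\<Sum>i<N. measure M (Q i) * indicator (T i) x) = (\<Sum>i\<in>I. measure M (Q i))"
      unfolding I_def by (intro sum.mono_neutral_cong_right) auto
    also have "\<dots> = measure M (\<Union>i\<in>I. Q i)" by (rule sum_Q) (simp add: I_def)
    also have "\<dots> \<le> measure M ((\<lambda>y. x + y) ` U)"
    proof (rule measure_mono)
      show "(\<Union>i\<in>I. Q i) \<subseteq> (\<lambda>y. x + y) ` U"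
      proof
        fix z assume "z \<in> (\<Union>i\<in>I. Q i)"
        then obtain i where i: "i < N" "x \<in> T i" "z \<in> W i"
          using Q_sub by (auto simp: I_def)
        then obtain v y where v: "v \<in> V" "z = h i + v" "y \<in> X" "x = h i + y"
          by (auto simp: W_def T_def)
        then have "- y + v \<in> U" "z = x + (- y + v)" by (auto simp: V_def)
        then show "z \<in> (\<lambda>y. x + y) ` U" by blast
      qed
    qed (use U in \<open>simp add: borel_open open_translate\<close>)
    also have "\<dots> = measure M U" using U by (simp add: measure_translate)
    finally show ?thesis using True by simp
  next
    case False
    then show ?thesis by (auto simp: T_def indicator_def intro!: sum_nonpos)
  qed
  have sum_le: "(\<Sum>i<N. measure M (Q i) * measure M (T i)) \<le> measure M U * measure M Y"
  proof -
    have "(\<Sum>i<N. measure M (Q i) * measure M (T i)) =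
        (\<integral>x. (\<Sum>i<N. measure M (Q i) * indicator (T i) x) \<partial>M)"
      using T_sets by (subst Bochner_Integration.integral_sum)
        (auto intro!: integrable_mult_right integrable_real_indicator simp: less_top[symmetric])
    also have "\<dots> \<le> (\<integral>x. measure M U * indicator Y x \<partial>M)"
      using T_sets Y pointwise
      by (intro integral_mono Bochner_Integration.integrable_sum integrable_mult_right
          integrable_real_indicator) (auto simp: less_top[symmetric] compact_borel)
    also have "\<dots> = measure M U * measure M Y" using Y by (simp add: compact_borel)
    finally show ?thesis .
  qed
  show ?thesis
  \<comment> \<open>The weights sum to 1, so if every translate failed, the average in
    \<open>sum_le\<close> would be at least \<open>?c\<close>, which exceeds its upper
    bound.\<close>
  proof (rule ccontr)
    let ?c = "measure M Y * (measure M (uminus ` X) + e)"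
    assume "\<not> ?thesis"
    then have "?c \<le> measure M (T i)" for i by (auto simp: T_def not_le intro: less_imp_le)
    then have "(\<Sum>i<N. measure M (Q i) * ?c) \<le> (\<Sum>i<N. measure M (Q i) * measure M (T i))"
      by (intro sum_mono mult_left_mono) auto
    moreover have "(\<Sum>i<N. measure M (Q i) * ?c) = ?c"
      by (simp only: sum_distrib_right[symmetric] sum1 mult_1)
    moreover have "measure M U * measure M Y < ?c" using U(3) Ypos by simp
    ultimately show False using sum_le by linarith
  qed
qed

text \<open>With \<open>Y = UNIV\<close> the bound on small intersections compares \<open>X\<close>
  with \<open>- X\<close> in one direction; applied to \<open>- X\<close> it gives the
  other.\<close>

lemma measure_uminus:
  assumes "compact X"
  shows "measure M (uminus ` X) = measure M X"
proof -
  have le: "measure M X \<le> measure M (uminus ` X)" if "compact X" for X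
  proof (rule field_le_epsilon)
    fix e :: real assume "0 < e"
    from exists_small_intersection[OF that compact_UNIV this]
    obtain g where "measure M (UNIV \<inter> (\<lambda>x. g + x) ` X) \<le> measure M UNIV * (measure M (uminus ` X) + e)"
      by blast
    then show "measure M X \<le> measure M (uminus ` X) + e"
      using that prob_space by (simp add: measure_translate compact_borel)
  qed
  show ?thesis
    using le[OF assms] le[OF compact_uminus_image[OF assms]] by (simp add: image_image)
qed

text \<open>Pigeonhole: for \<open>z\<close> outside the sumset, \<open>X\<close> and
  \<open>z - Y\<close> would be disjoint with total measure above 1.\<close>

lemma sumset_eq_UNIV:
  assumes "compact X" "compact Y" "1 < measure M X + measure M Y"
  shows "sumset X Y = UNIV"
proof -
  have "z \<in> sumset X Y" for z
  proof (rule ccontr)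
    assume z: "z \<notin> sumset X Y"
    let ?Z = "(\<lambda>y. z + y) ` uminus ` Y"
    have "compact ?Z" using assms by (intro compact_translate compact_uminus_image)
    moreover have "X \<inter> ?Z = {}" using z by (force simp: mem_sumset)
    ultimately have "measure M (X \<union> ?Z) = measure M X + measure M ?Z"
      using assms by (intro finite_measure_Union) (auto simp: compact_borel)
    also have "measure M ?Z = measure M Y"
      using assms by (simp add: measure_translate compact_borel compact_uminus_image measure_uminus)
    finally show False using assms(3) prob_le_1[of "X \<union> ?Z"] by simp
  qed
  then show ?thesis by auto
qed

text \<open>For \<open>g\<close> and \<open>h\<close> near \<open>g0\<close>, both translates of
  \<open>X\<close> lie in \<open>g0 + U\<close>, whose measure exceeds theirs by less than
  \<open>e\<close>; so the intersections with \<open>X\<close> differ by less than \<open>e\<close>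
  in measure.\<close>

lemma continuous_measure_Int_translate:
  assumes X: "compact X"
  shows "continuous_on UNIV (\<lambda>g. measure M (X \<inter> (\<lambda>x. g + x) ` X))"
  unfolding continuous_on_def
proof (intro ballI tendstoI)
  fix g0 :: 'a and e :: real assume e: "0 < e"
  obtain U where U: "open U" "X \<subseteq> U" "measure M U < measure M X + e"
    using outer_regular[OF compact_borel[OF X] e] by blast
  define V where "V = {v. \<forall>x\<in>X. x + v \<in> U}"
  have V: "open V" "0 \<in> V"
    unfolding V_def using U open_translates_into[OF X] by auto
  let ?t = "\<lambda>g. (\<lambda>x. g + x) ` X"
  have t: "?t g \<in> sets borel" "measure M (?t g) = measure M X" for g
    using X by (auto simp: compact_borel compact_translate measure_translate)
  have U0: "(\<lambda>x. g0 + x) ` U \<in> sets borel" "measure M ((\<lambda>x. g0 + x) ` U) = measure M U"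
    using U by (auto simp: open_translate measure_translate)
  have le: "measure M (X \<inter> ?t g) < measure M (X \<inter> ?t h) + e"
    if "?t g \<subseteq> (\<lambda>x. g0 + x) ` U" "?t h \<subseteq> (\<lambda>x. g0 + x) ` U" for g h
  proof -
    have "measure M (X \<inter> ?t g) \<le> measure M ((X \<inter> ?t h) \<union> ((\<lambda>x. g0 + x) ` U - ?t h))"
      using that U0(1) t(1) compact_borel[OF X]
      by (intro measure_mono sets.Un sets.Int sets.Diff) auto
    also have "\<dots> \<le> measure M (X \<inter> ?t h) + measure M ((\<lambda>x. g0 + x) ` U - ?t h)"
      using U0 t X by (intro measure_Un_le) (auto simp: compact_borel)
    also have "measure M ((\<lambda>x. g0 + x) ` U - ?t h) = measure M U - measure M X"
      using that U0 t by (subst finite_measure_Diff) auto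
    finally show ?thesis using U(3) by linarith
  qed
  have sub: "?t g \<subseteq> (\<lambda>x. g0 + x) ` U" if "g - g0 \<in> V" for g
  proof
    fix z assume "z \<in> ?t g"
    then obtain x where "x \<in> X" "z = g0 + (x + (g - g0))" by (auto simp: algebra_simps)
    moreover from this have "x + (g - g0) \<in> U" using that by (auto simp: V_def)
    ultimately show "z \<in> (\<lambda>x. g0 + x) ` U" by blast
  qed
  have "open ((\<lambda>g. g - g0) -` V)" by (intro open_vimage V continuous_intros)
  then have "eventually (\<lambda>g. g - g0 \<in> V) (nhds g0)"
    using V(2) by (auto simp: eventually_nhds)
  then have "eventually (\<lambda>g. g - g0 \<in> V) (at g0)"
    by (auto simp: eventually_at_filter elim: eventually_mono)
  then show "eventually (\<lambda>g. dist (measure M (X \<inter> ?t g)) (measure M (X \<inter> ?t g0)) < e) (at g0)"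
  proof eventually_elim
    case (elim g)
    have "g0 - g0 \<in> V" using V by simp
    from le[OF sub[OF elim] sub[OF this]] le[OF sub[OF this] sub[OF elim]]
    show ?case by (simp add: dist_real_def abs_less_iff)
  qed
qed

text \<open>Intermediate value theorem on the connected group: \<open>g = 0\<close> gives the full
  measure of \<open>X\<close>, and averaging gives some \<open>g\<close> with value at most
  \<open>c\<close>.\<close>

lemma exists_intersection_of_measure:
  assumes conn: "connected (UNIV :: 'a set)" and X: "compact X"
    and c: "(measure M X)\<^sup>2 < c" "c \<le> measure M X"
  shows "\<exists>g. measure M (X \<inter> (\<lambda>x. g + x) ` X) = c"
proof -
  let ?f = "\<lambda>g. measure M (X \<inter> (\<lambda>x. g + x) ` X)"
  have m: "0 < measure M X"
    using c by (metis order_less_le_trans zero_le_power2 le_less_trans)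
  \<comment> \<open>This tolerance makes the bound \<open>m * (m + e)\<close> equal to
    \<open>c\<close>, where \<open>m\<close> is the measure of \<open>X\<close>.\<close>
  have "0 < c / measure M X - measure M X"
    using m c by (simp add: field_simps power2_eq_square)
  from exists_small_intersection[OF X X this]
  obtain g where "?f g \<le> measure M X * (measure M (uminus ` X) + (c / measure M X - measure M X))"
    by blast
  then have g: "?f g \<le> c" using m X by (simp add: measure_uminus)
  have "connected (range ?f)"
    by (intro connected_continuous_image continuous_measure_Int_translate X conn)
  moreover have "?f 0 = measure M X" by simp
  ultimately have "c \<in> range ?f"
    using g c(2) unfolding connected_iff_interval by (metis rangeI)
  then show ?thesis by auto
qed

section \<open>Kneser's inequality\<close>

text \<open>A failure makes the supremum \<open>c\<close> of the deficiency \<open>d\<close>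
  positive. Submodularity then replaces a near-maximiser by another whose measure is smaller by the
  fixed amount \<open>s\<close>; enough repetitions give a negative measure.\<close>

theorem kneser_inequality:
  assumes conn: "connected (UNIV :: 'a set)"
    and X: "compact X" "X \<noteq> {}" and Y: "compact Y" "Y \<noteq> {}"
  shows "min 1 (measure M X + measure M Y) \<le> measure M (sumset X Y)"
proof (rule ccontr)
  assume "\<not> ?thesis"
  then have X1: "measure M (sumset X Y) < 1" "measure M (sumset X Y) < measure M X + measure M Y"
    by auto
  define d where "d Z = measure M Z + measure M Y - measure M (sumset Z Y)" for Z
  define D where "D = {Z. compact Z \<and> Z \<noteq> {} \<and> measure M Z + measure M Y \<le> 1}"
  have "measure M X + measure M Y \<le> 1"
  proof (rule ccontr)
    assume "\<not> ?thesis"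
    then have "sumset X Y = UNIV" using X Y by (intro sumset_eq_UNIV) auto
    then show False using X1 prob_space by simp
  qed
  then have XD: "X \<in> D" using X by (simp add: D_def)
  \<comment> \<open>The sumset contains a translate of each nonempty summand.\<close>
  have d_le: "d Z \<le> measure M Z" "d Z \<le> measure M Y" if Z: "compact Z" "Z \<noteq> {}" for Z
  proof -
    have s: "sumset Z Y \<in> sets borel" using that Y by (simp add: compact_borel compact_sumset)
    obtain z y where zy: "z \<in> Z" "y \<in> Y" using Z(2) Y(2) by blast
    have "measure M Y = measure M ((\<lambda>x. z + x) ` Y)"
      using Y by (simp add: measure_translate compact_borel)
    also have "\<dots> \<le> measure M (sumset Z Y)"
      using zy s by (intro measure_mono) (auto simp: sumset_def)
    finally show "d Z \<le> measure M Z" by (simp add: d_def)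
    have "measure M Z = measure M ((\<lambda>x. y + x) ` Z)"
      using that by (simp add: measure_translate compact_borel)
    also have "\<dots> \<le> measure M (sumset Z Y)"
      using zy s by (intro measure_mono) (auto simp: sumset_def add.commute)
    finally show "d Z \<le> measure M Y" by (simp add: d_def)
  qed
  define c where "c = Sup (d ` D)"
  have bdd: "bdd_above (d ` D)"
    using d_le by (intro bdd_aboveI2[of _ _ 1]) (auto simp: D_def intro: order_trans[OF _ prob_le_1])
  have d_c: "d Z \<le> c" if "Z \<in> D" for Z
    unfolding c_def using bdd that by (auto intro: cSup_upper)
  have c0: "0 < c" using d_c[OF XD] X1 by (simp add: d_def)
  have c1: "c \<le> 1"
    unfolding c_def using XD d_le
    by (intro cSup_least) (auto simp: D_def intro: order_trans[OF _ prob_le_1])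
  \<comment> \<open>In \<open>step\<close>, both the measure \<open>m\<close> of \<open>Z\<close>
    and \<open>1 - m\<close> are at least \<open>c / 2\<close>, so \<open>m - m^2\<close> is at
    least \<open>c^2 / 4 = 2 * s\<close>. Hence \<open>m - s\<close> lies strictly above
    \<open>m^2\<close>, as the choice of \<open>g\<close> requires.\<close>
  define s where "s = c\<^sup>2 / 8"
  have s0: "0 < s" using c0 by (simp add: s_def)
  have sc: "s \<le> c" using c0 c1 mult_left_le[of c c] by (simp add: s_def power2_eq_square)
  \<comment> \<open>Submodularity: if \<open>Z\<close> nearly attains the supremum \<open>c\<close>, then so does \<open>Z \<inter> (g + Z)\<close>.\<close>
  have step: "\<exists>Z'\<in>D. measure M Z' = measure M Z - s \<and> c - 2 * \<delta> \<le> d Z'"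
    if Z: "Z \<in> D" "c - \<delta> \<le> d Z" and \<delta>: "\<delta> \<le> c / 2" for Z \<delta>
  proof -
    have cZ: "compact Z" "Z \<noteq> {}" "measure M Z + measure M Y \<le> 1" using Z by (auto simp: D_def)
    have m: "c / 2 \<le> measure M Z" "c / 2 \<le> 1 - measure M Z"
      using d_le[OF cZ(1,2)] Z(2) \<delta> cZ(3) by linarith+
    have "(c / 2) * (c / 2) \<le> measure M Z * (1 - measure M Z)"
      using m c0 by (intro mult_mono) auto
    then have "(measure M Z)\<^sup>2 < measure M Z - s"
      using s0 by (simp add: s_def power2_eq_square algebra_simps)
    from exists_intersection_of_measure[OF conn cZ(1) this] s0
    obtain g where g: "measure M (Z \<inter> (\<lambda>x. g + x) ` Z) = measure M Z - s" by auto
    let ?t = "(\<lambda>x. g + x) ` Z"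
    let ?I = "Z \<inter> ?t" and ?U = "Z \<union> ?t"
    have t: "compact ?t" "measure M ?t = measure M Z"
      using cZ by (auto simp: compact_translate measure_translate compact_borel)
    have cI: "compact ?I" using cZ t by (simp add: compact_Int)
    have cU: "compact ?U" using cZ t by (simp add: compact_Un)
    have "0 < measure M Z - s"
      using \<open>(measure M Z)\<^sup>2 < measure M Z - s\<close> by (meson le_less_trans zero_le_power2)
    then have "?I \<noteq> {}" using g by (metis measure_empty less_irrefl)
    then have ID: "?I \<in> D" using cI g cZ s0 by (simp add: D_def)
    have mU: "measure M ?U = measure M Z + s"
      using measure_Un3[of Z M ?t] cZ t g by (simp add: compact_borel fmeasurable_eq_sets)
    \<comment> \<open>The union may leave \<open>D\<close>. Its sumset with \<open>Y\<close> is then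
      the whole group, and its deficiency is at most \<open>s \<le> c\<close>.\<close>
    have dU: "d ?U \<le> c"
    proof (cases "measure M ?U + measure M Y \<le> 1")
      case True
      then show ?thesis using d_c[of ?U] cU cZ by (simp add: D_def)
    next
      case False
      then have "sumset ?U Y = UNIV" using cU Y by (intro sumset_eq_UNIV) auto
      then have "d ?U = measure M Z + s + measure M Y - 1" using mU prob_space by (simp add: d_def)
      then show ?thesis using cZ sc by linarith
    qed
    \<comment> \<open>Adding \<open>Y\<close> commutes with unions, while
      \<open>(Z \<inter> (g + Z)) + Y\<close> is only contained in the intersection of the two
      sumsets.\<close>
    have "measure M (sumset ?U Y) + measure M (sumset ?I Y) \<le>
        measure M (sumset Z Y \<union> sumset ?t Y) + measure M (sumset Z Y \<inter> sumset ?t Y)"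
      using cZ t Y sumset_mono[of ?I Z Y Y] sumset_mono[of ?I ?t Y Y]
      by (intro add_mono measure_mono) (auto simp: sumset_Un_left compact_borel compact_sumset)
    also have "\<dots> = measure M (sumset Z Y) + measure M (sumset ?t Y)"
      using measure_Un3[of "sumset Z Y" M "sumset ?t Y"] cZ t Y
      by (simp add: compact_borel compact_sumset fmeasurable_eq_sets)
    also have "measure M (sumset ?t Y) = measure M (sumset Z Y)"
      using cZ Y by (simp add: sumset_translate_left measure_translate compact_borel compact_sumset)
    finally have "2 * d Z \<le> d ?U + d ?I" using g mU by (simp add: d_def)
    then have "c - 2 * \<delta> \<le> d ?I" using dU Z(2) by linarith
    then show ?thesis using ID g by blast
  qed
  obtain K :: nat where K: "1 < real K * s"
    using s0 reals_Archimedean3 by blast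
  \<comment> \<open>The error doubles at each of the \<open>K\<close> steps; this start keeps it at
    most \<open>c / 2\<close>, the bound demanded by \<open>step\<close>.\<close>
  define \<delta> where "\<delta> = c / 2 ^ Suc K"
  have \<delta>0: "0 < \<delta>" using c0 by (simp add: \<delta>_def)
  then have "c - \<delta> < Sup (d ` D)" by (simp add: c_def)
  then obtain Z0 where Z0: "Z0 \<in> D" "c - \<delta> < d Z0"
    using less_cSup_iff[of "d ` D" "c - \<delta>"] XD bdd by auto
  have "k \<le> K \<longrightarrow> (\<exists>Z\<in>D. measure M Z \<le> 1 - real k * s \<and> c - 2 ^ k * \<delta> \<le> d Z)" for k
  proof (induction k)
    case 0
    then show ?case using Z0 by (auto intro!: bexI[of _ Z0])
  next
    case (Suc k)
    show ?case
    proof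
      assume k: "Suc k \<le> K"
      with Suc obtain Z where Z: "Z \<in> D" "measure M Z \<le> 1 - real k * s" "c - 2 ^ k * \<delta> \<le> d Z"
        by auto
      have "2 ^ k * \<delta> \<le> 2 ^ K * \<delta>" using k \<delta>0 by (intro mult_right_mono power_increasing) auto
      also have "\<dots> = c / 2" by (simp add: \<delta>_def)
      finally obtain Z' where "Z' \<in> D" "measure M Z' = measure M Z - s" "c - 2 * (2 ^ k * \<delta>) \<le> d Z'"
        using step[OF Z(1,3)] by auto
      then show "\<exists>Z\<in>D. measure M Z \<le> 1 - real (Suc k) * s \<and> c - 2 ^ Suc k * \<delta> \<le> d Z"
        using Z(2) by (intro bexI[of _ Z']) (auto simp: algebra_simps)
    qed
  qed
  from this[of K] obtain Z where "measure M Z \<le> 1 - real K * s" by auto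
  then show False using K measure_nonneg[of M Z] by linarith
qed

section \<open>The inequalities of Petridis and Pluennecke\<close>

text \<open>Petridis' argument. The infimum of \<open>measure M (sumset Z B) / measure M Z\<close> over compact
  \<open>Z\<close> need not be attained, so \<open>X\<close> is a minimiser up to \<open>\<delta>\<close> only; the error
  accumulates linearly in \<open>card C\<close>.\<close>

lemma petridis_inequality:
  assumes X: "compact X" and B: "open B" and C: "finite C" and K: "0 \<le> K"
    and near: "measure M (sumset X B) \<le> (K + \<delta>) * measure M X"
    and least: "\<And>Z. compact Z \<Longrightarrow> Z \<subseteq> X \<Longrightarrow> K * measure M Z \<le> measure M (sumset Z B)"
  shows "measure M (sumset (sumset X B) C) \<le>
    K * measure M (sumset X C) + real (card C) * \<delta> * measure M X"
  using C
proof (induction C rule: finite_induct)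
  case empty
  then show ?case by (simp add: sumset_def)
next
  case (insert c C)
  let ?S = "sumset (sumset X B) C" and ?T = "sumset X C"
  let ?Xc = "(\<lambda>x. x + c) ` X" and ?XBc = "(\<lambda>x. x + c) ` sumset X B"
  \<comment> \<open>\<open>Z + c\<close> is the overlap of \<open>X + c\<close> with
    \<open>X + C\<close>. Passing to \<open>insert c C\<close> thus adds
    \<open>\<mu>(X) - \<mu>(Z)\<close> to the measure of \<open>X + C\<close>, and at most
    \<open>\<mu>(X + B) - \<mu>(Z + B)\<close> to that of \<open>X + B + C\<close>, since
    \<open>Z + B + c\<close> is already covered.\<close>
  define Z where "Z = X \<inter> (\<lambda>x. - c + x) ` ?T"
  have T: "compact ?T" using X insert.hyps by (simp add: compact_sumset finite_imp_compact)
  have Z: "compact Z" "Z \<subseteq> X"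
    unfolding Z_def using compact_Int[OF X compact_translate[OF T, of "- c"]] by auto
  have XB: "open (sumset X B)" and ZB: "open (sumset Z B)"
    using B by (simp_all add: open_sumset)
  have S: "open ?S"
    using XB by (subst sumset_commute) (rule open_sumset)
  have Xc: "?Xc \<in> sets borel" "measure M ?Xc = measure M X"
    using X measure_translate[of X c] compact_translate[OF X, of c]
    by (auto simp: add.commute compact_borel)
  have XBc: "?XBc \<in> sets borel" "measure M ?XBc = measure M (sumset X B)"
    using XB measure_translate[of "sumset X B" c] open_translate[OF XB, of c]
    by (auto simp: add.commute)
  have Zc: "(\<lambda>x. x + c) ` Z = ?Xc \<inter> ?T"
  proof -
    have "x + c \<in> ?T \<longleftrightarrow> x \<in> (\<lambda>x. - c + x) ` ?T" for x
      by (auto simp: image_iff algebra_simps)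
    then show ?thesis by (auto simp: Z_def)
  qed
  have mZc: "measure M (?Xc \<inter> ?T) = measure M Z"
    using Z measure_translate[of Z c] by (simp add: Zc[symmetric] add.commute compact_borel)
  have sub: "(\<lambda>x. x + c) ` sumset Z B \<subseteq> ?XBc \<inter> ?S"
  proof
    fix y assume "y \<in> (\<lambda>x. x + c) ` sumset Z B"
    then obtain z b where zb: "z \<in> Z" "b \<in> B" "y = z + b + c" by (auto simp: mem_sumset)
    then have "z + c \<in> ?T" using Zc by blast
    then obtain x u where xu: "x \<in> X" "u \<in> C" "z + c = x + u" by (auto simp: mem_sumset)
    have "y = (z + c) + b" using zb by (simp add: algebra_simps)
    also have "\<dots> = (x + b) + u" using xu by (simp add: algebra_simps)
    finally have "y \<in> ?S" using xu(1,2) zb(2) unfolding sumset_def by blast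
    moreover have "y \<in> ?XBc" using zb Z(2) unfolding sumset_def by blast
    ultimately show "y \<in> ?XBc \<inter> ?S" by simp
  qed
  have "measure M (sumset Z B) = measure M ((\<lambda>x. x + c) ` sumset Z B)"
    using ZB measure_translate[of "sumset Z B" c] by (simp add: add.commute)
  also have "\<dots> \<le> measure M (?XBc \<inter> ?S)"
    using sub XBc S by (intro measure_mono) auto
  finally have 1: "K * measure M Z \<le> measure M (?XBc \<inter> ?S)"
    using least[OF Z] by linarith
  have 2: "measure M (sumset (sumset X B) (insert c C)) =
      measure M ?S + measure M (sumset X B) - measure M (?XBc \<inter> ?S)"
    using measure_Un3[of ?S M ?XBc] S XBc
    by (simp add: sumset_insert_right fmeasurable_eq_sets Int_commute)
  have 3: "measure M (sumset X (insert c C)) = measure M ?T + measure M X - measure M Z"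
    using measure_Un3[of ?T M ?Xc] T Xc mZc
    by (simp add: sumset_insert_right fmeasurable_eq_sets Int_commute compact_borel)
  have "measure M (sumset (sumset X B) (insert c C)) \<le>
     (K * measure M ?T + real (card C) * \<delta> * measure M X) + (K + \<delta>) * measure M X - K * measure M Z"
    using 1 2 insert.IH near by linarith
  also have "\<dots> = K * measure M (sumset X (insert c C)) + real (card (insert c C)) * \<delta> * measure M X"
    using insert.hyps by (simp add: 3 algebra_simps)
  finally show ?case .
qed

text \<open>A near-minimiser \<open>X\<close> of the growth ratio works for all finite sets
  \<open>C\<close> at once, so Petridis' inequality can be iterated with \<open>C = iF\<close>, each
  step costing a factor \<open>\<kappa>'\<close>.\<close>

lemma pluennecke_inequality:
  assumes A: "compact A" "0 < measure M A" and B: "open B"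
    and F: "finite F" "F \<noteq> {}" "F \<subseteq> B"
    and AB: "measure M (sumset A B) \<le> \<kappa> * measure M A" and \<kappa>: "\<kappa> < \<kappa>'"
  shows "\<exists>X\<subseteq>A. compact X \<and> 0 < measure M X \<and>
    measure M (sumset X (sumset B (nfold_sumset k F))) \<le> \<kappa>' ^ Suc k * measure M X"
proof -
  define r where "r Z = measure M (sumset Z B) / measure M Z" for Z
  define D where "D = {Z. compact Z \<and> Z \<subseteq> A \<and> 0 < measure M Z}"
  define K where "K = Inf (r ` D)"
  have AD: "A \<in> D" using A by (simp add: D_def)
  have bdd: "bdd_below (r ` D)" by (intro bdd_belowI2[of _ 0]) (simp add: r_def)
  have K0: "0 \<le> K" unfolding K_def using AD by (intro cInf_greatest) (auto simp: r_def)
  have "K \<le> r A" unfolding K_def using AD bdd by (intro cInf_lower) auto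
  also have "r A \<le> \<kappa>" using A AB by (simp add: r_def field_simps)
  finally have K\<kappa>: "K \<le> \<kappa>" .
  \<comment> \<open>\<open>N\<close> bounds the cardinality of every \<open>iF\<close> in the
    iteration, so one \<open>\<delta>\<close> keeps all accumulated errors within
    \<open>\<kappa>' - \<kappa>\<close>.\<close>
  define N where "N = (\<Sum>i\<le>k. card (nfold_sumset i F))"
  have card_le: "card (nfold_sumset i F) \<le> N" if "i \<le> k" for i
    unfolding N_def using that member_le_sum[of i "{..k}" "\<lambda>i. card (nfold_sumset i F)"] by auto
  have "0 < N"
    using card_le[of 0] by (simp add: nfold_sumset_0)
  define \<delta> where "\<delta> = (\<kappa>' - \<kappa>) / N"
  have \<delta>: "0 < \<delta>" "real N * \<delta> = \<kappa>' - \<kappa>" using \<kappa> \<open>0 < N\<close> by (simp_all add: \<delta>_def)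
  have "Inf (r ` D) < K + \<delta>" using \<delta> by (simp add: K_def)
  then obtain X where XD: "X \<in> D" and Xr: "r X < K + \<delta>"
    using cInf_less_iff[of "r ` D" "K + \<delta>"] AD bdd by auto
  have X: "compact X" "X \<subseteq> A" "0 < measure M X" using XD by (auto simp: D_def)
  have near: "measure M (sumset X B) \<le> (K + \<delta>) * measure M X"
    using Xr X by (simp add: r_def field_simps)
  have least: "K * measure M Z \<le> measure M (sumset Z B)" if "compact Z" "Z \<subseteq> X" for Z
  proof (cases "measure M Z = 0")
    case False
    then have "Z \<in> D" "0 < measure M Z"
      using that X by (auto simp: D_def zero_less_measure_iff)
    then have "K \<le> r Z" unfolding K_def using bdd by (intro cInf_lower) auto
    then show ?thesis using \<open>0 < measure M Z\<close> by (simp add: r_def field_simps)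
  qed simp
  have grow: "measure M (sumset X (sumset B (nfold_sumset i F))) \<le>
      \<kappa>' * measure M (sumset X (nfold_sumset i F))" if "i \<le> k" for i
  proof -
    let ?C = "nfold_sumset i F"
    have fin: "finite ?C" using F by (simp add: finite_nfold_sumset)
    obtain u where u: "u \<in> ?C" using nfold_sumset_nonempty[OF F(2)] by blast
    have "measure M X = measure M ((\<lambda>x. u + x) ` X)"
      using X by (simp add: measure_translate compact_borel)
    also have "\<dots> \<le> measure M (sumset X ?C)"
      \<comment> \<open>\<open>X + C\<close> contains a translate of \<open>X\<close>; this turns
        the additive error of Petridis' inequality into a multiplicative one.\<close>
      using u compact_sumset[OF X(1) finite_imp_compact[OF fin]]
      by (intro measure_mono compact_borel) (fastforce simp: mem_sumset add.commute)
    finally have X_le: "measure M X \<le> measure M (sumset X ?C)" .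
    have "measure M (sumset X (sumset B ?C)) \<le>
        K * measure M (sumset X ?C) + real (card ?C) * \<delta> * measure M X"
      using petridis_inequality[OF X(1) B fin K0 near least] by (simp add: sumset_assoc)
    also have "\<dots> \<le> K * measure M (sumset X ?C) + real N * \<delta> * measure M (sumset X ?C)"
      using card_le[OF that] \<delta>(1) X_le by (intro add_left_mono mult_mono) auto
    also have "\<dots> = (K + (\<kappa>' - \<kappa>)) * measure M (sumset X ?C)"
      by (simp add: \<delta>(2) distrib_right)
    also have "\<dots> \<le> \<kappa>' * measure M (sumset X ?C)"
      using K\<kappa> by (intro mult_right_mono) auto
    finally show ?thesis .
  qed
  have \<kappa>'0: "0 \<le> \<kappa>'" using K0 K\<kappa> \<kappa> by linarith
  have iter: "i \<le> k \<longrightarrow> measure M (sumset X (nfold_sumset i F)) \<le> \<kappa>' ^ i * measure M X" for i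
  proof (induction i)
    case 0
    then show ?case by (simp add: nfold_sumset_0 sumset_def)
  next
    case (Suc i)
    show ?case
    proof
      assume i: "Suc i \<le> k"
      \<comment> \<open>One summand \<open>F\<close> is enlarged to \<open>B\<close>, which brings
        the set into the form handled by \<open>grow\<close>.\<close>
      have "measure M (sumset X (nfold_sumset (Suc i) F)) \<le>
          measure M (sumset X (sumset B (nfold_sumset i F)))"
      proof (rule measure_mono)
        show "sumset X (nfold_sumset (Suc i) F) \<subseteq> sumset X (sumset B (nfold_sumset i F))"
          unfolding nfold_sumset_Suc sumset_commute[of "nfold_sumset i F" F]
          using F by (intro sumset_mono) auto
        show "sumset X (sumset B (nfold_sumset i F)) \<in> sets borel"
          using B by (simp add: sumset_commute[of B] open_sumset)
      qed
      also have "\<dots> \<le> \<kappa>' * measure M (sumset X (nfold_sumset i F))" using grow i by simp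
      also have "\<dots> \<le> \<kappa>' * (\<kappa>' ^ i * measure M X)"
        using Suc i \<kappa>'0 by (intro mult_left_mono) auto
      finally show "measure M (sumset X (nfold_sumset (Suc i) F)) \<le> \<kappa>' ^ Suc i * measure M X"
        by simp
    qed
  qed
  have "measure M (sumset X (sumset B (nfold_sumset k F))) \<le> \<kappa>' * (\<kappa>' ^ k * measure M X)"
    using grow[of k] iter[of k] \<kappa>'0 by (meson mult_left_mono order_refl order_trans)
  then show ?thesis using X by (auto intro!: exI[of _ X])
qed

section \<open>The bound for compact \<open>A\<close> and open \<open>B\<close>\<close>

text \<open>Finitely many translates \<open>s + B\<close> with \<open>s \<in> kB\<close> cover
  \<open>D\<close>; \<open>F\<close> collects the summands of these \<open>s\<close>.\<close>

lemma exists_finite_nfold_cover: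
  fixes B D :: "'a set"
  assumes B: "open B" and D: "compact D" "D \<subseteq> nfold_sumset (Suc k) B"
  shows "\<exists>F. finite F \<and> F \<subseteq> B \<and> D \<subseteq> sumset B (nfold_sumset k F)"
proof -
  let ?N = "nfold_sumset k B"
  have "D \<subseteq> (\<Union>s\<in>?N. (\<lambda>x. s + x) ` B)"
    using D by (fastforce simp: nfold_sumset_Suc mem_sumset)
  then obtain P where P: "P \<subseteq> ?N" "finite P" "D \<subseteq> (\<Union>s\<in>P. (\<lambda>x. s + x) ` B)"
    using compactE_image[OF D(1), of ?N "\<lambda>s. (\<lambda>x. s + x) ` B"] B open_translate by metis
  have "\<forall>s\<in>P. \<exists>b. s = (\<Sum>i<k. b i) \<and> (\<forall>i<k. b i \<in> B)"
    using P by (auto simp: nfold_sumset_def)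
  then obtain b where b: "\<And>s. s \<in> P \<Longrightarrow> s = (\<Sum>i<k. b s i)" "\<And>s i. s \<in> P \<Longrightarrow> i < k \<Longrightarrow> b s i \<in> B"
    by metis
  define F where "F = (\<Union>s\<in>P. b s ` {..<k})"
  have "P \<subseteq> nfold_sumset k F"
    using b(1) by (fastforce simp: nfold_sumset_def F_def)
  moreover have "D \<subseteq> sumset P B"
    using P(3) by (fastforce simp: mem_sumset)
  ultimately have "D \<subseteq> sumset B (nfold_sumset k F)"
    using sumset_mono[of P "nfold_sumset k F" B B] by (simp add: sumset_commute[of B])
  then show ?thesis
    using P b by (intro exI[of _ F]) (auto simp: F_def)
qed

lemma measure_nfold_sumset_le_open:
  assumes conn: "connected (UNIV :: 'a set)"
    and A: "compact A" "0 < measure M A" and B: "open B" "B \<noteq> {}"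
    and AB: "measure M (sumset A B) \<le> \<kappa> * measure M A"
    and n: "0 < n" "\<kappa> ^ n * measure M A < 1"
  shows "measure M (nfold_sumset n B) \<le> (\<kappa> ^ n - 1) * measure M A"
proof -
  obtain k where k: "n = Suc k" using n by (cases n) auto
  have compact_case: "measure M D \<le> (\<kappa> ^ n - 1) * measure M A"
    if D: "compact D" "D \<noteq> {}" "D \<subseteq> nfold_sumset n B" for D
  proof (rule le_if_le_perturbed_power[OF n(2)])
    fix \<kappa>' assume \<kappa>': "\<kappa> < \<kappa>'" "\<kappa>' ^ n * measure M A < 1"
    obtain F0 where F0: "finite F0" "F0 \<subseteq> B" "D \<subseteq> sumset B (nfold_sumset k F0)"
      using exists_finite_nfold_cover[of B D k] B D k by auto
    obtain b where b: "b \<in> B" using B by auto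
    \<comment> \<open>\<open>F0\<close> may be empty, for instance when \<open>k = 0\<close>; a
      point of \<open>B\<close> is added to make it nonempty.\<close>
    define F where "F = insert b F0"
    have F: "finite F" "F \<noteq> {}" "F \<subseteq> B" using F0 b by (auto simp: F_def)
    have DF: "D \<subseteq> sumset B (nfold_sumset k F)"
      using F0(3) sumset_mono[OF order_refl nfold_sumset_mono[of F0 F k], of B]
      by (auto simp: F_def)
    obtain X where X: "X \<subseteq> A" "compact X" "0 < measure M X"
      "measure M (sumset X (sumset B (nfold_sumset k F))) \<le> \<kappa>' ^ n * measure M X"
      using pluennecke_inequality[OF A B(1) F AB \<kappa>'(1), of k] k by auto
    have "X \<noteq> {}" using X(3) by auto
    have "min 1 (measure M X + measure M D) \<le> measure M (sumset X D)"
      using kneser_inequality[OF conn X(2) \<open>X \<noteq> {}\<close> D(1,2)] .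
    also have "\<dots> \<le> measure M (sumset X (sumset B (nfold_sumset k F)))"
      using DF B by (intro measure_mono sumset_mono) (auto simp: sumset_commute[of B] open_sumset)
    also have "\<dots> \<le> \<kappa>' ^ n * measure M X" by fact
    finally have le: "min 1 (measure M X + measure M D) \<le> \<kappa>' ^ n * measure M X" .
    have XA: "measure M X \<le> measure M A" using X A by (intro measure_mono) (auto simp: compact_borel)
    have "0 < \<kappa>' ^ n * measure M X"
      using le X(3) by (smt (verit) measure_nonneg min_def)
    then have "0 < \<kappa>' ^ n" using X(3) by (simp add: zero_less_mult_iff)
    then have "\<kappa>' ^ n * measure M X \<le> \<kappa>' ^ n * measure M A"
      using XA by (intro mult_left_mono) auto
    \<comment> \<open>The right side is at most \<open>\<kappa>' ^ n * measure M A < 1\<close>, so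
      the minimum in Kneser's inequality is not 1.\<close>
    then have le': "measure M X + measure M D \<le> \<kappa>' ^ n * measure M X"
      using le \<kappa>'(2) by linarith
    then have "1 * measure M X \<le> \<kappa>' ^ n * measure M X"
      using measure_nonneg[of M D] by linarith
    then have "1 \<le> \<kappa>' ^ n" using X(3) mult_le_cancel_right_pos by blast
    have "measure M D \<le> (\<kappa>' ^ n - 1) * measure M X" using le' by (simp add: algebra_simps)
    also have "\<dots> \<le> (\<kappa>' ^ n - 1) * measure M A"
      using XA \<open>1 \<le> \<kappa>' ^ n\<close> by (intro mult_left_mono) auto
    finally show "measure M D \<le> (\<kappa>' ^ n - 1) * measure M A" .
  qed
  have op: "open (nfold_sumset n B)" using B by (simp add: k nfold_sumset_Suc open_sumset)
  obtain u where u: "u \<in> nfold_sumset n B" using nfold_sumset_nonempty[OF B(2)] by blast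
  show ?thesis
  proof (rule field_le_epsilon)
    fix e :: real assume "0 < e"
    then obtain D where D: "compact D" "D \<subseteq> nfold_sumset n B"
        "measure M (nfold_sumset n B) - e < measure M D"
      using inner_regular[of "nfold_sumset n B" e] op by auto
    \<comment> \<open>Kneser's inequality needs a nonempty set, and \<open>D\<close> might be
      empty.\<close>
    have "measure M D \<le> measure M (insert u D)"
      using D by (intro measure_mono compact_borel compact_insert) auto
    also have "\<dots> \<le> (\<kappa> ^ n - 1) * measure M A"
      using D u by (intro compact_case compact_insert) auto
    finally show "measure M (nfold_sumset n B) \<le> (\<kappa> ^ n - 1) * measure M A + e"
      using D(3) by linarith
  qed
qed

section \<open>Completed measure and reduction to the compact-open case\<close>

lemma completion_inner_regular:
  assumes "S \<in> sets (completion M)" "0 < e"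
  shows "\<exists>K. compact K \<and> K \<subseteq> S \<and> measure (completion M) S - e < measure M K"
proof -
  have S: "main_part M S \<in> sets borel" "main_part M S \<subseteq> S"
    using main_part_sets[OF assms(1)] main_part_null_part_Un[OF assms(1)] by auto
  have "measure (completion M) S = measure M (main_part M S)"
    using assms by (simp add: measure_def)
  then show ?thesis using inner_regular[OF S(1) assms(2)] S(2) by auto
qed

lemma completion_outer_regular:
  assumes "S \<in> sets (completion M)" "0 < e"
  shows "\<exists>U. open U \<and> S \<subseteq> U \<and> measure M U < measure (completion M) S + e"
proof -
  obtain T where T: "S \<subseteq> T" "T \<in> sets M" "emeasure (completion M) S = emeasure M T"
    using completion_upper[OF assms(1)] by metis
  then have "measure (completion M) S = measure M T" by (simp add: measure_def)
  then show ?thesis using outer_regular[of T e] T assms(2) by auto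
qed

end

text \<open>K-analytic sets and their sumsets need not be Borel, which is why the measure is
  completed.\<close>

theorem theorem1p4:
  fixes \<mu> :: "'a::{topological_ab_group_add, t2_space} measure"
    and A B :: "'a set" and \<alpha> :: real and n :: nat
  assumes "compact (UNIV :: 'a set)" and "connected (UNIV :: 'a set)"
    and "haar_probability \<mu>"
    and "K_analytic TYPE('y1) A" and "K_analytic TYPE('y2) B"
    and "0 < measure (completion \<mu>) (sumset A B)"
    and "measure (completion \<mu>) (sumset A B) \<le> \<alpha> * measure (completion \<mu>) A"
    and "0 < n"
    and "\<alpha> ^ n < 1 / measure (completion \<mu>) A"
  shows "measure (completion \<mu>) (nfold_sumset n B) \<le> (\<alpha> ^ n - 1) * measure (completion \<mu>) A"
proof -
  interpret compact_haar \<mu> using assms by unfold_locales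
  interpret c: prob_space "completion \<mu>" by (rule prob_space_completion)
  let ?m = "measure (completion \<mu>)"
  \<comment> \<open>Non-measurable sets have measure 0 here, so the hypotheses force measurability.\<close>
  have sumset_sets: "sumset A B \<in> sets (completion \<mu>)"
    using assms(6) measure_notin_sets by fastforce
  have "0 < \<alpha> * ?m A" using assms(6,7) by linarith
  then have A0: "0 < ?m A" and \<alpha>0: "0 < \<alpha>"
    using measure_nonneg[of "completion \<mu>" A] by (auto simp: zero_less_mult_iff)
  then have A_sets: "A \<in> sets (completion \<mu>)" using measure_notin_sets by fastforce
  have "B \<noteq> {}" using assms(6) by (auto simp: sumset_def)
  show ?thesis
  proof (rule le_if_le_perturbed_power)
    show "\<alpha> ^ n * ?m A < 1" using assms(9) A0 by (simp add: field_simps)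
    fix \<beta> assume \<beta>: "\<alpha> < \<beta>" "\<beta> ^ n * ?m A < 1"
    have \<beta>0: "0 < \<beta>" using \<alpha>0 \<beta> by linarith
    \<comment> \<open>With this tolerance \<open>\<beta> * measure \<mu> A'\<close> strictly exceeds
      \<open>\<alpha> * ?m A\<close>, which leaves room for the open set \<open>U\<close> around the
      sumset.\<close>
    have "0 < ?m A - \<alpha> / \<beta> * ?m A" using A0 \<beta> \<beta>0 by (simp add: field_simps)
    from completion_inner_regular[OF A_sets this]
    obtain A' where A': "compact A'" "A' \<subseteq> A" "\<alpha> / \<beta> * ?m A < measure \<mu> A'" by auto
    have A'0: "0 < measure \<mu> A'"
      using A'(3) A0 \<alpha>0 \<beta>0 by (smt (verit) divide_pos_pos mult_pos_pos)
    have "\<alpha> * ?m A < \<beta> * measure \<mu> A'" using A'(3) \<beta>0 by (simp add: field_simps)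
    then have "0 < \<beta> * measure \<mu> A' - ?m (sumset A B)" using assms(7) by linarith
    from completion_outer_regular[OF sumset_sets this]
    obtain U where U: "open U" "sumset A B \<subseteq> U" "measure \<mu> U < \<beta> * measure \<mu> A'" by auto
    define B' where "B' = {b. \<forall>a\<in>A'. a + b \<in> U}"
    have B': "open B'" "B \<subseteq> B'"
      using open_translates_into[OF A'(1) U(1)] A'(2) U(2) by (auto simp: B'_def sumset_def)
    have "measure \<mu> (sumset A' B') \<le> measure \<mu> U"
      using U by (intro measure_mono) (auto simp: B'_def sumset_def)
    then have A'B': "measure \<mu> (sumset A' B') \<le> \<beta> * measure \<mu> A'" using U(3) by linarith
    have A'A: "measure \<mu> A' \<le> ?m A"
      using c.finite_measure_mono[OF A'(2) A_sets] compact_borel[OF A'(1)] by simp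
    have "\<beta> ^ n * measure \<mu> A' < 1"
      using mult_left_mono[OF A'A, of "\<beta> ^ n"] \<beta>(2) zero_le_power[of \<beta> n] \<beta>0 by linarith
    then have le: "measure \<mu> (nfold_sumset n B') \<le> (\<beta> ^ n - 1) * measure \<mu> A'"
      using measure_nfold_sumset_le_open[OF assms(2) A'(1) A'0 B'(1) _ A'B' assms(8)] B'(2) \<open>B \<noteq> {}\<close>
      by auto
    then have "0 \<le> (\<beta> ^ n - 1) * measure \<mu> A'"
      using measure_nonneg order_trans by blast
    then have \<beta>1: "0 \<le> \<beta> ^ n - 1" using A'0 by (simp add: zero_le_mult_iff)
    have "open (nfold_sumset n B')"
      using assms(8) B'(1) by (cases n) (auto simp: nfold_sumset_Suc open_sumset)
    \<comment> \<open>Monotonicity asks only the larger set to be measurable, and \<open>nB'\<close>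
      is open.\<close>
    then have "?m (nfold_sumset n B) \<le> measure \<mu> (nfold_sumset n B')"
      using c.finite_measure_mono[OF nfold_sumset_mono[OF B'(2)], of n] by simp
    also note le
    also have "(\<beta> ^ n - 1) * measure \<mu> A' \<le> (\<beta> ^ n - 1) * ?m A"
      using A'A \<beta>1 by (rule mult_left_mono)
    finally show "?m (nfold_sumset n B) \<le> (\<beta> ^ n - 1) * ?m A" .
  qed
qed

end
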